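(* Let $\mathcal J$ be an ideal on $\omega$ which is a $P^+(\mathcal J)$-ideal and is $\le_{KB}$-homogeneous. (1) Assume CH. The following conditions are equivalent: (a) $\mathcal{ED}_{\mathrm{Fin}}\not\le_{KB}\mathcal J$; (b) there is a Q-point which is not a $\mathcal J$-point; (c) there is a Q-point which is not a weak $\mathcal J$-ultrafilter. (2) If $\mathcal J$ is $F_\sigma$, then CH can be relaxed to the assumption $\mathfrak p=\mathfrak c$ in (1).
   Context: An ideal on a set $X$ is a family of subsets of $X$ closed under finite unions and subsets, containing all finite subsets of $X$ and not containing $X$; $\mathcal J^+=\mathcal P(X)\setminus\mathcal J$. $F_\sigma$ refers to the topology of $\mathcal P(\omega)\cong\{0,1\}^\omega$. $\mathfrak c=2^{\aleph_0}$, and $\mathfrak p$ is the usual pseudointersection number. With $\Delta=\{(n,k)\in\omega^2:n\ge k\}$, $\mathcal{ED}_{\mathrm{Fin}}=\{A\subseteq\Delta:\exists m\ \forall n\ |\{k:(n,k)\in A\}|<m\}$, an ideal on $\Delta$. For ideals $\mathcal I$ on $X$ and $\mathcal K$ on $Y$, $\mathcal I\le_{KB}\mathcal K$ ($\mathcal I\le_P\mathcal K$) means that there is a finite-to-one (one-to-one, respectively) function $f:Y\to X$ with $f^{-1}[B]\in\mathcal K$ for all $B\in\mathcal I$. $\mathcal J$ is a $P^+(\mathcal J)$-ideal if for each decreasing sequence $A_0\supseteq A_1\supseteq\dots$ of sets from $\mathcal J^+$ there is $B\in\mathcal J^+$ with $B\setminus A_n\in\mathcal J$ for all $n$. For $A\in\mathcal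 J^+$, $\mathcal J\restriction A=\{B\cap A:B\in\mathcal J\}$ (an ideal on $A$); $\mathcal J$ is $\le_{KB}$-homogeneous if $\mathcal J\restriction A\le_{KB}\mathcal J$ and $\mathcal J\le_{KB}\mathcal J\restriction A$ for every $A\in\mathcal J^+$. Ultrafilters on $\omega$ contain all cofinite sets; $\mathcal U^*=\{\omega\setminus A:A\in\mathcal U\}$. $\mathcal U$ is a weak $\mathcal J$-ultrafilter ($\mathcal J$-point) if $\mathcal J\not\le_{KB}\mathcal U^*$ ($\mathcal J\not\le_P\mathcal U^*$, respectively). $\mathcal U$ is a Q-point if for each partition $\{A_n:n\in\omega\}$ of $\omega$ into finite sets there is $A\in\mathcal U$ with $|A\cap A_n|=1$ for each $n$. *)

theory Defs
  imports "HOL-Analysis.Analysis" "HOL-Library.Disjoint_Sets"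
begin

unbundle cardinal_syntax

definition ideal_on :: "'a set \<Rightarrow> 'a set set \<Rightarrow> bool" where
  "ideal_on X J \<longleftrightarrow>
     J \<subseteq> Pow X \<and>
     (\<forall>A\<in>J. \<forall>B\<in>J. A \<union> B \<in> J) \<and>
     (\<forall>A\<in>J. \<forall>B. B \<subseteq> A \<longrightarrow> B \<in> J) \<and>
     (\<forall>A. A \<subseteq> X \<and> finite A \<longrightarrow> A \<in> J) \<and>
     X \<notin> J"

definition positive :: "'a set \<Rightarrow> 'a set set \<Rightarrow> 'a set set" where
  "positive X J = Pow X - J"

definition restr :: "'a set set \<Rightarrow> 'a set \<Rightarrow> 'a set set" where
  "restr J A = {B \<inter> A | B. B \<in> J}"

definition finite_to_one_on :: "('b \<Rightarrow> 'a) \<Rightarrow> 'b set \<Rightarrow> bool" where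
  "finite_to_one_on f Y \<longleftrightarrow> (\<forall>x. finite {y \<in> Y. f y = x})"

definition KB_le :: "'a set \<Rightarrow> 'a set set \<Rightarrow> 'b set \<Rightarrow> 'b set set \<Rightarrow> bool" where
  "KB_le X I Y K \<longleftrightarrow>
     (\<exists>f. f \<in> Y \<rightarrow> X \<and> finite_to_one_on f Y \<and> (\<forall>B\<in>I. f -` B \<inter> Y \<in> K))"

definition P_le :: "'a set \<Rightarrow> 'a set set \<Rightarrow> 'b set \<Rightarrow> 'b set set \<Rightarrow> bool" where
  "P_le X I Y K \<longleftrightarrow>
     (\<exists>f. f \<in> Y \<rightarrow> X \<and> inj_on f Y \<and> (\<forall>B\<in>I. f -` B \<inter> Y \<in> K))"

definition P_plus_ideal :: "'a set \<Rightarrow> 'a set set \<Rightarrow> bool" where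
  "P_plus_ideal X J \<longleftrightarrow>
     (\<forall>A :: nat \<Rightarrow> 'a set. decseq A \<and> (\<forall>n. A n \<in> positive X J) \<longrightarrow>
        (\<exists>B\<in>positive X J. \<forall>n. B - A n \<in> J))"

definition KB_homogeneous :: "'a set \<Rightarrow> 'a set set \<Rightarrow> bool" where
  "KB_homogeneous X J \<longleftrightarrow>
     (\<forall>A\<in>positive X J. KB_le A (restr J A) X J \<and> KB_le X J A (restr J A))"

definition Delta :: "(nat \<times> nat) set" where
  "Delta = {(n, k). n \<ge> k}"

definition ED_Fin :: "(nat \<times> nat) set set" where
  "ED_Fin = {A. A \<subseteq> Delta \<and> (\<exists>m. \<forall>n. card {k. (n, k) \<in> A} < m)}"

text \<open>Subsets of \<open>\<omega>\<close> are identified with their characteristic functions in \<open>{0,1}\<^sup>\<omega>\<close>.\<close>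

definition F_sigma :: "nat set set \<Rightarrow> bool" where
  "F_sigma J \<longleftrightarrow>
     fsigma_in (product_topology (\<lambda>_. discrete_topology (UNIV :: bool set)) (UNIV :: nat set))
       ((\<lambda>A n. n \<in> A) ` J)"

definition ultrafilter_nat :: "nat set set \<Rightarrow> bool" where
  "ultrafilter_nat U \<longleftrightarrow>
     {} \<notin> U \<and>
     (\<forall>A\<in>U. \<forall>B\<in>U. A \<inter> B \<in> U) \<and>
     (\<forall>A\<in>U. \<forall>B. A \<subseteq> B \<longrightarrow> B \<in> U) \<and>
     (\<forall>A. A \<in> U \<or> UNIV - A \<in> U) \<and>
     (\<forall>A. finite (UNIV - A) \<longrightarrow> A \<in> U)"

definition dual :: "nat set set \<Rightarrow> nat set set" where
  "dual U = {UNIV - A | A. A \<in> U}"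

definition weak_J_ultrafilter :: "nat set set \<Rightarrow> nat set set \<Rightarrow> bool" where
  "weak_J_ultrafilter J U \<longleftrightarrow> ultrafilter_nat U \<and> \<not> KB_le UNIV J UNIV (dual U)"

definition J_point :: "nat set set \<Rightarrow> nat set set \<Rightarrow> bool" where
  "J_point J U \<longleftrightarrow> ultrafilter_nat U \<and> \<not> P_le UNIV J UNIV (dual U)"

text \<open>A partition of \<open>\<omega>\<close> into finite sets has infinitely many blocks, so it is
  automatically of the form \<open>{A\<^sub>n : n \<in> \<omega>}\<close>.\<close>

definition Q_point :: "nat set set \<Rightarrow> bool" where
  "Q_point U \<longleftrightarrow> ultrafilter_nat U \<and>
     (\<forall>P. partition_on UNIV P \<and> (\<forall>p\<in>P. finite p) \<longrightarrow>
        (\<exists>A\<in>U. \<forall>p\<in>P. card (A \<inter> p) = 1))"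

abbreviation continuum where
  "continuum \<equiv> ctwo ^c natLeq"

definition CH :: bool where
  "CH \<longleftrightarrow> continuum =o cardSuc natLeq"

definition strong_fip :: "nat set set \<Rightarrow> bool" where
  "strong_fip F \<longleftrightarrow> (\<forall>G. G \<subseteq> F \<and> finite G \<longrightarrow> infinite (\<Inter>G))"

definition pseudointersection :: "nat set \<Rightarrow> nat set set \<Rightarrow> bool" where
  "pseudointersection P F \<longleftrightarrow> infinite P \<and> (\<forall>A\<in>F. finite (P - A))"

definition p_witness :: "nat set set \<Rightarrow> bool" where
  "p_witness F \<longleftrightarrow> strong_fip F \<and> (\<nexists>P. pseudointersection P F)"

text \<open>The cardinal \<open>p\<close> is the least cardinality of a family with the strong finite
  intersection property and no infinite pseudointersection; the description is
  justified by the lemma \<open>p_number_least\<close> below.\<close>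

definition p_number :: "nat set rel" where
  "p_number = |SOME F. p_witness F \<and> (\<forall>G. p_witness G \<longrightarrow> |F| \<le>o |G| )|"

lemma p_witness_exists: "\<exists>F. p_witness F"
proof (rule ccontr)
  assume no: "\<nexists>F. p_witness F"
  have "\<exists>M\<in>{F. strong_fip F}. \<forall>X\<in>{F. strong_fip F}. M \<subseteq> X \<longrightarrow> X = M"
  proof (rule subset_Zorn)
    fix C assume C: "subset.chain {F. strong_fip F} C"
    show "\<exists>U\<in>{F. strong_fip F}. \<forall>X\<in>C. X \<subseteq> U"
    proof (cases "C = {}")
      case True
      have "strong_fip {}" by (simp add: strong_fip_def)
      then show ?thesis using True by auto
    next
      case False
      have "strong_fip (\<Union>C)"
        unfolding strong_fip_def
      proof (intro allI impI)
        fix G assume G: "G \<subseteq> \<Union>C \<and> finite G"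
        obtain F where "F \<in> C" "G \<subseteq> F"
          using finite_subset_Union_chain[of G C "{F. strong_fip F}"] G False C by blast
        moreover from this C have "strong_fip F"
          by (auto simp: subset_chain_def)
        ultimately show "infinite (\<Inter>G)"
          using G by (auto simp: strong_fip_def)
      qed
      then show ?thesis by blast
    qed
  qed
  then obtain M where M: "strong_fip M" and max: "\<And>X. strong_fip X \<Longrightarrow> M \<subseteq> X \<Longrightarrow> X = M"
    by blast
  obtain P where P: "infinite P" "\<And>A. A \<in> M \<Longrightarrow> finite (P - A)"
    using no M by (auto simp: p_witness_def pseudointersection_def)
  have in_M: "Q \<in> M" if Q: "infinite Q" "Q \<subseteq> P" for Q
  proof -
    have "strong_fip (insert Q M)"
      unfolding strong_fip_def
    proof (intro allI impI)
      fix G assume G: "G \<subseteq> insert Q M \<and> finite G"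
      have "finite (\<Union>A\<in>G - {Q}. P - A)"
        using G P(2) by blast
      moreover have "Q \<subseteq> \<Inter>G \<union> (\<Union>A\<in>G - {Q}. P - A)"
        using Q by blast
      ultimately show "infinite (\<Inter>G)"
        using Q(1) finite_subset by blast
    qed
    then show ?thesis using max[of "insert Q M"] by blast
  qed
  define Q where "Q = range (\<lambda>n. enumerate P (2 * n))"
  define R where "R = range (\<lambda>n. enumerate P (Suc (2 * n)))"
  have inj: "inj (enumerate P)"
    using P(1) by (simp add: strict_mono_enumerate strict_mono_imp_inj_on)
  have "infinite Q" "infinite R"
    unfolding Q_def R_def
    by (intro range_inj_infinite injI; use injD[OF inj] in fastforce)+
  moreover have "Q \<subseteq> P" "R \<subseteq> P"
    unfolding Q_def R_def using P(1) by (auto intro: enumerate_in_set)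
  ultimately have "{Q, R} \<subseteq> M" using in_M by blast
  then have "infinite (\<Inter>{Q, R})"
    using M unfolding strong_fip_def by blast
  moreover have "Q \<inter> R = {}"
  proof -
    have "enumerate P (2 * m) \<noteq> enumerate P (Suc (2 * n))" for m n
      using injD[OF inj, of "2 * m" "Suc (2 * n)"] by presburger
    then show ?thesis by (auto simp: Q_def R_def)
  qed
  ultimately show False by simp
qed

lemma p_number_least:
  "\<exists>F. p_witness F \<and> p_number = |F|"
  "p_witness G \<Longrightarrow> p_number \<le>o |G|"
proof -
  have "\<exists>r\<in>card_of ` {F. p_witness F}. \<forall>r'\<in>card_of ` {F. p_witness F}. r \<le>o r'"
    using p_witness_exists by (intro exists_minim_Card_order) (auto simp: card_of_Card_order)
  then have "\<exists>F. p_witness F \<and> (\<forall>G. p_witness G \<longrightarrow> |F| \<le>o |G| )"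
    by blast
  from someI_ex[OF this] show "\<exists>F. p_witness F \<and> p_number = |F|"
    "p_witness G \<Longrightarrow> p_number \<le>o |G|"
    unfolding p_number_def by blast+
qed

end

theory Submission
  imports Defs "HOL-Library.Countable_Set_Type"
begin

text \<open>
  If a Q-point \<open>U\<close> satisfies \<open>J \<le>\<^sub>K\<^sub>B U\<^sup>*\<close>, then \<open>ED\<^sub>F\<^sub>i\<^sub>n \<le>\<^sub>K\<^sub>B J\<close> would give a finite-to-one map from
  \<open>\<omega>\<close> to \<open>\<Delta>\<close>; a selector in \<open>U\<close> of the preimages of the columns has its image in \<open>ED\<^sub>F\<^sub>i\<^sub>n\<close>, which is
  absurd.  Conversely, suppose \<open>ED\<^sub>F\<^sub>i\<^sub>n\<close> is not below \<open>J\<close>.  By homogeneity, every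
  \<open>J\<close>-positive set contains a \<open>J\<close>-positive partial selector of any given partition into finite sets:
  otherwise an injection placing the blocks into distinct columns would witness
  \<open>ED\<^sub>F\<^sub>i\<^sub>n \<le>\<^sub>K\<^sub>B J \<restriction> A\<close>.  A tower of \<open>J\<close>-positive sets, decreasing modulo \<open>J\<close>, of
  length at most continuum then meets all partitions, and any ultrafilter extending the tower and the
  dual filter of \<open>J\<close> is a Q-point for which the identity witnesses \<open>J \<le>\<^sub>P U\<^sup>*\<close>.  At limit stages
  CH reduces to countable families, handled by the \<open>P\<^sup>+\<close>-property; for \<open>J\<close> an \<open>F\<^sub>\<sigma>\<close>
  ideal, a pseudointersection of a family of sets of finite approximations of positive sets works.
\<close>

section \<open>Positivity, partial selectors and the Katetov-Blass order\<close>

text \<open>The strong finite intersection property with "infinite" replaced by "not in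
  \<open>J\<close>". The empty \<open>G\<close> is allowed, and
  \<open>\<Inter>{} = UNIV\<close>.\<close>

definition positive_fip :: "'a set set \<Rightarrow> 'a set set \<Rightarrow> bool" where
  "positive_fip J F \<longleftrightarrow> (\<forall>G. G \<subseteq> F \<and> finite G \<longrightarrow> \<Inter>G \<notin> J)"

text \<open>Blocks may be missed, which makes the property hereditary to subsets;
  \<open>Q_point_if_partial_selectors\<close> fills the missed blocks.\<close>

definition partial_selector :: "'a set set \<Rightarrow> 'a set \<Rightarrow> bool" where
  "partial_selector P B \<longleftrightarrow> (\<forall>p\<in>P. \<forall>x\<in>B \<inter> p. \<forall>y\<in>B \<inter> p. x = y)"

lemma positive_fipD: "positive_fip J F \<Longrightarrow> G \<subseteq> F \<Longrightarrow> finite G \<Longrightarrow> \<Inter>G \<notin> J"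
  by (simp add: positive_fip_def)

lemma ideal_onD:
  assumes "ideal_on X J"
  shows ideal_on_Un: "A \<in> J \<Longrightarrow> B \<in> J \<Longrightarrow> A \<union> B \<in> J"
    and ideal_on_subset: "A \<in> J \<Longrightarrow> B \<subseteq> A \<Longrightarrow> B \<in> J"
    and ideal_on_finite: "A \<subseteq> X \<Longrightarrow> finite A \<Longrightarrow> A \<in> J"
    and ideal_on_space: "X \<notin> J"
  using assms unfolding ideal_on_def by blast+

lemma ideal_on_UN:
  assumes "ideal_on X J" "finite I" "\<And>i. i \<in> I \<Longrightarrow> A i \<in> J"
  shows "(\<Union>i\<in>I. A i) \<in> J"
  using assms(2,3)
  by (induction I rule: finite_induct)
     (auto intro: ideal_on_Un[OF assms(1)] ideal_on_finite[OF assms(1)])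

lemma KB_le_trans:
  assumes "KB_le X I Y K" "KB_le Y K Z L"
  shows "KB_le X I Z L"
proof -
  obtain f where f: "f \<in> Y \<rightarrow> X" "finite_to_one_on f Y" "\<And>B. B \<in> I \<Longrightarrow> f -` B \<inter> Y \<in> K"
    using assms(1) unfolding KB_le_def by blast
  obtain g where g: "g \<in> Z \<rightarrow> Y" "finite_to_one_on g Z" "\<And>B. B \<in> K \<Longrightarrow> g -` B \<inter> Z \<in> L"
    using assms(2) unfolding KB_le_def by blast
  have "finite {z \<in> Z. (f \<circ> g) z = x}" for x
  proof (rule finite_subset)
    show "{z \<in> Z. (f \<circ> g) z = x} \<subseteq> (\<Union>y\<in>{y \<in> Y. f y = x}. {z \<in> Z. g z = y})"
      using g(1) by auto
    show "finite (\<Union>y\<in>{y \<in> Y. f y = x}. {z \<in> Z. g z = y})"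
      using f(2) g(2) by (intro finite_UN_I) (simp_all add: finite_to_one_on_def)
  qed
  moreover have "(f \<circ> g) -` B \<inter> Z \<in> L" if "B \<in> I" for B
  proof -
    have "(f \<circ> g) -` B \<inter> Z = g -` (f -` B \<inter> Y) \<inter> Z" using g(1) by auto
    then show ?thesis using f(3)[OF that] g(3) by presburger
  qed
  moreover have "f \<circ> g \<in> Z \<rightarrow> X" using f(1) g(1) by auto
  ultimately show ?thesis unfolding KB_le_def finite_to_one_on_def by blast
qed

lemma P_le_imp_KB_le:
  assumes "P_le X I Y K"
  shows "KB_le X I Y K"
proof -
  have "finite {y \<in> Y. f y = x}" if "inj_on f Y" for f :: "'b \<Rightarrow> 'a" and x
    using finite_vimage_IntI[OF _ that, of "{x}"]
    by (auto simp: vimage_def Int_def conj_commute)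
  then show ?thesis
    using assms unfolding KB_le_def P_le_def finite_to_one_on_def by blast
qed

lemma ultrafilter_natD:
  assumes "ultrafilter_nat U"
  shows ultrafilter_nat_empty: "{} \<notin> U"
    and ultrafilter_nat_Int: "A \<in> U \<Longrightarrow> B \<in> U \<Longrightarrow> A \<inter> B \<in> U"
    and ultrafilter_nat_mono: "A \<in> U \<Longrightarrow> A \<subseteq> B \<Longrightarrow> B \<in> U"
    and ultrafilter_nat_compl: "A \<notin> U \<Longrightarrow> UNIV - A \<in> U"
  using assms unfolding ultrafilter_nat_def by blast+

section \<open>Q-points are not above \<open>ED_Fin\<close>\<close>

lemma ED_Fin_not_KB_le_Q_point:
  assumes "Q_point U"
  shows "\<not> KB_le Delta ED_Fin UNIV (dual U)"
proof
  assume "KB_le Delta ED_Fin UNIV (dual U)"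
  then obtain f :: "nat \<Rightarrow> nat \<times> nat" where f: "\<And>x. f x \<in> Delta" "\<And>y. finite {x. f x = y}"
      "\<And>B. B \<in> ED_Fin \<Longrightarrow> f -` B \<in> dual U"
    unfolding KB_le_def finite_to_one_on_def Pi_iff by auto metis
  have uf: "ultrafilter_nat U" using assms by (simp add: Q_point_def)
  \<comment> \<open>Indexing by the columns that \<open>f\<close> hits keeps the blocks nonempty.
    They are finite because columns of \<open>Delta\<close> are finite and \<open>f\<close> is
    finite-to-one.\<close>
  define P where "P = (\<lambda>n. {x. fst (f x) = n}) ` range (fst \<circ> f)"
  have fin: "finite {x. fst (f x) = n}" for n
  proof (rule finite_subset)
    show "{x. fst (f x) = n} \<subseteq> (\<Union>y\<in>{n} \<times> {..n}. {x. f x = y})"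
    proof
      fix x assume "x \<in> {x. fst (f x) = n}"
      then have "f x \<in> {n} \<times> {..n}" using f(1)[of x] by (auto simp: Delta_def split_beta mem_Times_iff)
      then show "x \<in> (\<Union>y\<in>{n} \<times> {..n}. {x. f x = y})" by blast
    qed
    show "finite (\<Union>y\<in>{n} \<times> {..n}. {x. f x = y})" using f(2) by blast
  qed
  have "partition_on UNIV P"
    unfolding partition_on_def disjoint_def P_def by auto
  moreover have "\<forall>p\<in>P. finite p" using fin by (auto simp: P_def)
  ultimately obtain A where A: "A \<in> U" "\<And>p. p \<in> P \<Longrightarrow> card (A \<inter> p) = 1"
    using assms unfolding Q_point_def by blast
  \<comment> \<open>A selector contributes at most one point to each column, so its image is in
    \<open>ED_Fin\<close> with bound 2.\<close>
  have "card {k. (n, k) \<in> f ` A} < 2" for n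
  proof (cases "n \<in> range (fst \<circ> f)")
    case True
    then have "card (A \<inter> {x. fst (f x) = n}) = 1" using A(2) by (simp add: P_def)
    then obtain a where a: "A \<inter> {x. fst (f x) = n} = {a}" by (auto simp: card_1_singleton_iff)
    have "{k. (n, k) \<in> f ` A} \<subseteq> {snd (f a)}"
    proof
      fix k assume "k \<in> {k. (n, k) \<in> f ` A}"
      then obtain x where x: "x \<in> A" "f x = (n, k)" by (auto simp: image_iff eq_commute)
      then have "x \<in> A \<inter> {x. fst (f x) = n}" by simp
      then have "x = a" using a by blast
      then show "k \<in> {snd (f a)}" using x by simp
    qed
    then have "card {k. (n, k) \<in> f ` A} \<le> card {snd (f a)}" by (intro card_mono) auto
    then show ?thesis by simp
  next
    case False
    have "{k. (n, k) \<in> f ` A} = {}"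
    proof (rule ccontr)
      assume "{k. (n, k) \<in> f ` A} \<noteq> {}"
      then obtain k x where "(n, k) = f x" by blast
      then have "n = (fst \<circ> f) x" by (metis comp_apply fst_conv)
      then show False using False by blast
    qed
    then show ?thesis by simp
  qed
  then have "\<exists>m. \<forall>n. card {k. (n, k) \<in> f ` A} < m" by blast
  then have "f ` A \<in> ED_Fin" using f(1) by (simp add: ED_Fin_def image_subset_iff)
  then have "f -` (f ` A) \<in> dual U" by (rule f(3))
  then obtain C where C: "C \<in> U" "f -` (f ` A) = UNIV - C" unfolding dual_def by blast
  have "A \<subseteq> UNIV - C" unfolding C(2)[symmetric] by blast
  then have "A \<inter> C = {}" by blast
  then show False using ultrafilter_nat_Int[OF uf A(1) C(1)] ultrafilter_nat_empty[OF uf] by simp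
qed

section \<open>Positive partial selectors\<close>

lemma partition_on_unique:
  assumes "partition_on A P" "p \<in> P" "q \<in> P" "x \<in> p" "x \<in> q"
  shows "p = q"
  using disjointD[OF partition_onD2[OF assms(1)] assms(2,3)] assms(4,5) by blast

text \<open>Inject each block into a column of its own. A set with fewer than \<open>m\<close>
  points per column then pulls back to a union of \<open>m\<close> partial selectors, each of which
  is in \<open>J\<close> by \<open>sel\<close>.\<close>

lemma ED_Fin_KB_le_restr:
  fixes J :: "nat set set"
  assumes J: "ideal_on UNIV J" and "A \<notin> J"
    and P: "partition_on UNIV P" "\<forall>p\<in>P. finite p"
    and sel: "\<And>B. B \<subseteq> A \<Longrightarrow> partial_selector P B \<Longrightarrow> B \<in> J"
  shows "KB_le Delta ED_Fin A (restr J A)"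
proof -
  have "countable P"
  proof (rule countable_subset)
    show "P \<subseteq> Fpow UNIV" using P(2) by (auto simp: Fpow_def)
    show "countable (Fpow (UNIV :: nat set))"
      using countable_Collect_finite by (auto simp: Fpow_def)
  qed
  then obtain e :: "nat set \<Rightarrow> nat" where e: "inj_on e P" by (auto simp: countable_def)
  define blk where "blk x = (THE p. p \<in> P \<and> x \<in> p)" for x
  have blk: "blk x \<in> P \<and> x \<in> blk x" for x
    unfolding blk_def
  proof (rule theI')
    show "\<exists>!p. p \<in> P \<and> x \<in> p"
      using partition_onD1[OF P(1)] partition_on_unique[OF P(1)] by (intro ex_ex1I) auto
  qed
  have blk_eq: "p = blk x" if "p \<in> P" "x \<in> p" for p x
    using blk[of x] that partition_on_unique[OF P(1)] by blast
  \<comment> \<open>The index of \<open>x\<close> in the increasing enumeration of its block,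
    counted from 0.\<close>
  define pos where "pos x = card {y \<in> blk x. y < x}" for x
  have fin: "finite (blk x)" for x using blk P(2) by blast
  have pos_le: "pos x \<le> card (blk x)" for x
    unfolding pos_def by (intro card_mono fin) auto
  have pos_less: "pos x < pos y" if "x < y" "blk x = blk y" for x y
    unfolding pos_def
  proof (rule psubset_card_mono)
    show "finite {z \<in> blk y. z < y}" using fin[of y] by simp
    show "{z \<in> blk x. z < x} \<subset> {z \<in> blk y. z < y}" using that blk[of x] by auto
  qed
  \<comment> \<open>The column of a block must determine the block and be at least as large as it.\<close>
  define col where "col x = prod_encode (e (blk x), card (blk x))" for x
  define f where "f x = (col x, pos x)" for x
  have "card (blk x) \<le> col x" for x
    unfolding col_def by (rule le_prod_encode_2)
  then have Delta: "f x \<in> Delta" for x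
    unfolding f_def Delta_def using order_trans[OF pos_le] by simp
  have col_blk: "blk x = blk y" if "col x = col y" for x y
    using that e blk[of x] blk[of y] by (simp add: col_def inj_on_def)
  have inj: "inj f"
  proof (rule injI)
    fix x y assume "f x = f y"
    then have "blk x = blk y" "pos x = pos y" using col_blk[of x y] by (simp_all add: f_def)
    then show "x = y" using pos_less[of x y] pos_less[of y x] by (cases x y rule: linorder_cases) auto
  qed
  have "f -` B \<inter> A \<in> restr J A" if B: "B \<in> ED_Fin" for B
  proof -
    obtain m where m: "\<And>n. card {k. (n, k) \<in> B} < m" and BD: "B \<subseteq> Delta"
      using B by (auto simp: ED_Fin_def)
    have finB: "finite {k. (n, k) \<in> B}" for n
      by (rule finite_subset[of _ "{..n}"]) (use BD in \<open>auto simp: Delta_def\<close>)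
    \<comment> \<open>\<open>D i\<close> collects the points of the preimage whose image is the
      \<open>i\<close>-th point of \<open>B\<close> in its column below which \<open>i\<close>
      points of \<open>B\<close> lie; hence one point per block at most, and only ranks below
      \<open>m\<close> occur.\<close>
    define rank where "rank x = card {k. (col x, k) \<in> B \<and> k < pos x}" for x
    define D where "D i = {x \<in> f -` B \<inter> A. rank x = i}" for i
    have rank_less: "rank x < rank y" if "f x \<in> B" "f y \<in> B" "blk x = blk y" "pos x < pos y" for x y
      unfolding rank_def
    proof (rule psubset_card_mono)
      show "finite {k. (col y, k) \<in> B \<and> k < pos y}" by simp
      have "col x = col y" using that(3) by (simp add: col_def)
      then show "{k. (col x, k) \<in> B \<and> k < pos x} \<subset> {k. (col y, k) \<in> B \<and> k < pos y}"
        using that by (auto simp: f_def)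
    qed
    have "D i \<in> J" for i
    proof (rule sel)
      show "D i \<subseteq> A" by (auto simp: D_def)
      show "partial_selector P (D i)"
        unfolding partial_selector_def
      proof (intro ballI)
        fix p x y assume p: "p \<in> P" and x: "x \<in> D i \<inter> p" and y: "y \<in> D i \<inter> p"
        have b: "blk x = blk y" using blk_eq[OF p] x y by blast
        have "pos x = pos y"
          using rank_less[of x y] rank_less[of y x] x y b
          by (cases "pos x" "pos y" rule: linorder_cases) (auto simp: D_def)
        then have "f x = f y" using b by (simp add: f_def col_def)
        then show "x = y" using inj by (simp add: inj_eq)
      qed
    qed
    then have "(\<Union>i<m. D i) \<in> J" by (intro ideal_on_UN[OF J]) auto
    moreover have "f -` B \<inter> A \<subseteq> (\<Union>i<m. D i)"
    proof
      fix x assume x: "x \<in> f -` B \<inter> A"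
      have "rank x \<le> card {k. (col x, k) \<in> B}"
        unfolding rank_def by (intro card_mono finB) auto
      then have "rank x < m" using m order_le_less_trans by blast
      then show "x \<in> (\<Union>i<m. D i)" using x by (auto simp: D_def)
    qed
    ultimately have "f -` B \<inter> A \<in> J" using ideal_on_subset[OF J] by blast
    then show ?thesis unfolding restr_def by blast
  qed
  moreover have "finite_to_one_on f A"
  proof -
    have "finite {x \<in> A. f x = z}" for z
    proof (rule finite_subset)
      show "finite (f -` {z})" using inj by (simp add: finite_vimageI)
    qed auto
    then show ?thesis by (simp add: finite_to_one_on_def)
  qed
  ultimately show ?thesis using Delta unfolding KB_le_def by blast
qed

text \<open>If no such \<open>B\<close> existed, \<open>ED_Fin\<close> would be below
  \<open>restr J A\<close>, which homogeneity puts below \<open>J\<close>.\<close>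

lemma positive_partial_selector:
  fixes J :: "nat set set"
  assumes J: "ideal_on UNIV J" and hom: "KB_homogeneous UNIV J"
    and nle: "\<not> KB_le Delta ED_Fin UNIV J"
    and A: "A \<notin> J" and P: "partition_on UNIV P" "\<forall>p\<in>P. finite p"
  shows "\<exists>B\<subseteq>A. B \<notin> J \<and> partial_selector P B"
proof (rule ccontr)
  assume "\<not> ?thesis"
  then have "KB_le Delta ED_Fin A (restr J A)"
    using ED_Fin_KB_le_restr[OF J A P] by blast
  moreover have "KB_le A (restr J A) UNIV J"
    using hom A by (simp add: KB_homogeneous_def positive_def)
  ultimately show False using nle KB_le_trans by blast
qed

section \<open>Lower bounds modulo \<open>J\<close> for families smaller than the continuum\<close>

lemma continuum_ordIso: "continuum =o |UNIV :: nat set set|"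
proof -
  have "continuum = |Func (UNIV :: nat set) (UNIV :: bool set)|"
    by (simp add: cexp_def ctwo_def Field_natLeq Field_card_of)
  then show ?thesis
    using card_of_Pow_Func[of "UNIV :: nat set"] by (simp add: ordIso_symmetric)
qed

text \<open>Under CH the family is countable; intersecting initial segments of an enumeration yields
  a decreasing sequence of positive sets, to which the \<open>P_plus_ideal\<close> property
  applies.\<close>

lemma CH_lower_bound:
  fixes J :: "nat set set"
  assumes CH and J: "ideal_on UNIV J" and pp: "P_plus_ideal UNIV J"
    and F: "|F| <o continuum" and fip: "positive_fip J F"
  shows "\<exists>B. B \<notin> J \<and> (\<forall>A\<in>F. B - A \<in> J)"
proof -
  have "|F| <o cardSuc natLeq"
    using F \<open>CH\<close> ordLess_ordIso_trans unfolding CH_def by blast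
  then have "|F| \<le>o natLeq"
    using cardSuc_ordLeq_ordLess[OF natLeq_Card_order card_of_Card_order] by blast
  then have cF: "countable F" by (simp add: countable_card_le_natLeq)
  show ?thesis
  proof (cases "F = {}")
    case True
    have "\<Inter>{} \<notin> J" by (rule positive_fipD[OF fip]) simp_all
    then show ?thesis using True by blast
  next
    case False
    define A where "A n = \<Inter>(from_nat_into F ` {..n})" for n
    have "A n \<notin> J" for n
      unfolding A_def using from_nat_into[OF False] by (intro positive_fipD[OF fip]) auto
    moreover have "decseq A"
      unfolding A_def decseq_def by (intro allI impI Inter_anti_mono image_mono) auto
    ultimately have "\<exists>B\<in>positive UNIV J. \<forall>n. B - A n \<in> J"
      using pp by (simp add: P_plus_ideal_def positive_def)
    then obtain B where B: "B \<notin> J" "\<And>n. B - A n \<in> J"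
      unfolding positive_def by blast
    have "B - X \<in> J" if X: "X \<in> F" for X
    proof -
      obtain n where "X = from_nat_into F n"
        using from_nat_into_surj[OF cF X] by blast
      then have "A n \<subseteq> X" unfolding A_def by blast
      then have "B - X \<subseteq> B - A n" by blast
      then show ?thesis using ideal_on_subset[OF J B(2)] by blast
    qed
    then show ?thesis using B(1) by blast
  qed
qed

text \<open>Compactness of the Cantor space: each \<open>C n\<close> is closed, so if every finite
  part of \<open>A\<close> is covered by a member of \<open>C n\<close>, one member covers all of
  \<open>A\<close>.\<close>

lemma F_sigma_finite_approximations:
  assumes "F_sigma J"
  obtains C where "J = (\<Union>n. C n)" "incseq C"
    "\<And>n A. (\<And>s. finite s \<Longrightarrow> s \<subseteq> A \<Longrightarrow> \<exists>B\<in>C n. s \<subseteq> B) \<Longrightarrow> \<exists>B\<in>C n. A \<subseteq> B"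
proof -
  let ?X = "product_topology (\<lambda>_. discrete_topology (UNIV :: bool set)) (UNIV :: nat set)"
  let ?chi = "\<lambda>A n. n \<in> (A :: nat set)"
  obtain K where K: "\<And>n. closedin ?X (K n)" "\<And>n. K n \<subseteq> K (Suc n)" "\<Union> (range K) = ?chi ` J"
    using assms unfolding F_sigma_def fsigma_in_ascending by blast
  define C where "C n = Collect ` K n" for n
  have in_C: "B \<in> C n \<longleftrightarrow> ?chi B \<in> K n" for B n
    unfolding C_def by force
  have "compact_space ?X"
    by (simp add: compact_space_product_topology compact_space_discrete_topology)
  have "B \<in> J \<longleftrightarrow> ?chi B \<in> \<Union> (range K)" for B
    unfolding K(3) by (simp add: image_iff fun_eq_iff set_eq_iff[symmetric])
  then have "J = (\<Union>n. C n)" by (auto simp: in_C)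
  moreover have "incseq C"
    unfolding C_def by (intro incseq_SucI image_mono K(2))
  moreover have "\<exists>B\<in>C n. A \<subseteq> B"
    if ap: "\<And>s. finite s \<Longrightarrow> s \<subseteq> A \<Longrightarrow> \<exists>B\<in>C n. s \<subseteq> B" for n A
  proof -
    define V where "V a = {h \<in> topspace ?X. h a \<in> {True}}" for a
    have V: "closedin ?X (V a)" for a
      unfolding V_def
      by (rule closedin_continuous_map_preimage[OF continuous_map_product_projection]) simp_all
    \<comment> \<open>A point of \<open>\<Inter>W\<close> is the characteristic function of a member
      of \<open>C n\<close> that contains \<open>A\<close>.\<close>
    define W where "W = insert (K n) (V ` A)"
    have "\<Inter>W \<noteq> {}"
    proof (rule compact_space_fip[THEN iffD1, OF \<open>compact_space ?X\<close>, rule_format])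
      show "Ball W (closedin ?X) \<and> (\<forall>G. finite G \<and> G \<subseteq> W \<longrightarrow> \<Inter>G \<noteq> {})"
      proof (intro conjI allI impI)
        show "Ball W (closedin ?X)" using K(1) V by (auto simp: W_def)
        fix G assume G: "finite G \<and> G \<subseteq> W"
        then have "finite (G - {K n})" "G - {K n} \<subseteq> V ` A" unfolding W_def by blast+
        from finite_subset_image[OF this]
        obtain s where s: "s \<subseteq> A" "finite s" "G - {K n} = V ` s"
          by (elim exE conjE) (rule that)
        obtain B where "B \<in> C n" "s \<subseteq> B" using ap[OF s(2,1)] by blast
        have "?chi B \<in> Y" if "Y \<in> G" for Y
        proof (cases "Y = K n")
          case True
          then show ?thesis using \<open>B \<in> C n\<close> in_C by simp
        next
          case False
          then have "Y \<in> V ` s" using that s(3) by blast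
          then show ?thesis using \<open>s \<subseteq> B\<close> by (auto simp: V_def)
        qed
        then show "\<Inter>G \<noteq> {}" by blast
      qed
    qed
    then obtain h where h: "h \<in> K n" "\<And>a. a \<in> A \<Longrightarrow> h a" by (auto simp: W_def V_def)
    then have "Collect h \<in> C n" "A \<subseteq> Collect h" unfolding C_def by blast+
    then show ?thesis by (rule bexI[rotated])
  qed
  ultimately show thesis by (rule that)
qed

lemma pseudointersection_if_small:
  assumes "strong_fip F" "|F| <o p_number"
  obtains P where "pseudointersection P F"
  using assms p_number_least(2) not_ordLess_ordLeq unfolding p_witness_def by blast

text \<open>The sets \<open>S A\<close> for \<open>A \<in> F\<close> and \<open>T n\<close> form a
  family with the strong finite intersection property on the countable set of codes. A
  pseudointersection \<open>P\<close> of it is decoded to the union of the finite sets that its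
  elements code.\<close>

lemma F_sigma_lower_bound:
  assumes "F_sigma J" and pc: "p_number =o continuum" and J: "ideal_on UNIV J"
    and F: "|F| <o continuum" and fip: "positive_fip J F"
  shows "\<exists>B. B \<notin> J \<and> (\<forall>A\<in>F. B - A \<in> J)"
proof -
  obtain C where C: "J = (\<Union>n. C n)" "incseq C"
    and ap: "\<And>n A. (\<And>s. finite s \<Longrightarrow> s \<subseteq> A \<Longrightarrow> \<exists>B\<in>C n. s \<subseteq> B) \<Longrightarrow> \<exists>B\<in>C n. A \<subseteq> B"
    by (rule F_sigma_finite_approximations[OF \<open>F_sigma J\<close>]) blast
  \<comment> \<open>A code \<open>c\<close> stands for a level \<open>lev c\<close> and a finite set \<open>fs c\<close>; a set is positive iff it
     contains \<open>fs c\<close> for some \<open>c \<in> T n\<close>, for every \<open>n\<close>.\<close>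
  define lev where "lev c = fst (from_nat c :: nat \<times> nat list)" for c
  define fs where "fs c = set (snd (from_nat c :: nat \<times> nat list))" for c
  define S where "S A = {c. fs c \<subseteq> A}" for A
  define T where "T n = {c. n \<le> lev c \<and> (\<forall>B\<in>C (lev c). \<not> fs c \<subseteq> B)}" for n
  have inf: "infinite (S A \<inter> T n)" if "A \<notin> J" for A n
  proof
    assume fin: "finite (S A \<inter> T n)"
    \<comment> \<open>A level above \<open>n\<close> and above all levels in the supposedly finite
      set. Since \<open>A\<close> lies in no member of \<open>C m\<close>, some finite
      \<open>s \<subseteq> A\<close> does not either, and the code of \<open>(m, s)\<close> is a new
      element.\<close>
    define m where "m = Suc (Max (insert n (lev ` (S A \<inter> T n))))"
    have "\<not> (\<exists>B\<in>C m. A \<subseteq> B)"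
      using \<open>A \<notin> J\<close> unfolding C(1) using ideal_on_subset[OF J, unfolded C(1)] by blast
    then obtain s where s: "finite s" "s \<subseteq> A" "\<forall>B\<in>C m. \<not> s \<subseteq> B"
      using ap[of A m] by blast
    obtain l where "set l = s" using s(1) finite_list by blast
    then have c: "lev (to_nat (m, l)) = m" "fs (to_nat (m, l)) = s"
      by (simp_all add: lev_def fs_def)
    have "n \<le> Max (insert n (lev ` (S A \<inter> T n)))" using fin by (intro Max_ge) auto
    then have "to_nat (m, l) \<in> S A \<inter> T n"
      using c s by (simp add: S_def T_def m_def)
    then have "lev (to_nat (m, l)) \<le> Max (insert n (lev ` (S A \<inter> T n)))"
      using fin by (intro Max_ge) blast+
    then show False using c(1) by (simp add: m_def)
  qed
  have "strong_fip (S ` F \<union> range T)"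
    unfolding strong_fip_def
  proof (intro allI impI)
    fix G assume G: "G \<subseteq> S ` F \<union> range T \<and> finite G"
    then have fin: "finite (G \<inter> S ` F)" "finite (G \<inter> range T)" by blast+
    obtain H where H: "H \<subseteq> F" "finite H" "G \<inter> S ` F = S ` H"
      using finite_subset_image[OF fin(1) Int_lower2] by (elim exE conjE) (rule that)
    obtain N where N: "finite N" "G \<inter> range T = T ` N"
      using finite_subset_image[OF fin(2) Int_lower2] by (elim exE conjE) (rule that)
    \<comment> \<open>\<open>T\<close> is decreasing, so its largest index suffices;
      \<open>insert 0\<close> covers empty \<open>N\<close>.\<close>
    have "S (\<Inter>H) \<inter> T (Max (insert 0 N)) \<subseteq> \<Inter>G"
    proof
      fix c assume c: "c \<in> S (\<Inter>H) \<inter> T (Max (insert 0 N))"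
      have "c \<in> T n" if "n \<in> N" for n
      proof -
        have "n \<le> Max (insert 0 N)" using N(1) that by (intro Max_ge) auto
        then show ?thesis using c order_trans by (auto simp: T_def)
      qed
      moreover have "c \<in> S A" if "A \<in> H" for A using c that by (auto simp: S_def)
      moreover have "G = S ` H \<union> T ` N"
        using G H(3) N(2) by (metis Int_Un_distrib Int_absorb2)
      ultimately show "c \<in> \<Inter>G" by blast
    qed
    moreover have "\<Inter>H \<notin> J" by (rule positive_fipD[OF fip H(1,2)])
    ultimately show "infinite (\<Inter>G)" using inf finite_subset by blast
  qed
  moreover have "|S ` F \<union> range T| <o p_number"
  proof -
    have "|S ` F| <o |UNIV :: nat set set|"
      using ordLeq_ordLess_trans[OF card_of_image] ordLess_ordIso_trans[OF F continuum_ordIso]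
      by blast
    moreover have "|range T| <o |UNIV :: nat set set|"
      using ordLeq_ordLess_trans[OF card_of_image card_of_Pow[of "UNIV :: nat set"]] by simp
    ultimately have "|S ` F \<union> range T| <o |UNIV :: nat set set|"
      by (intro card_of_Un_ordLess_infinite) (simp_all add: Finite_Set.finite_set)
    then show ?thesis
      using ordIso_symmetric[OF ordIso_transitive[OF pc continuum_ordIso]] ordLess_ordIso_trans
      by blast
  qed
  ultimately obtain P where P: "infinite P" "\<And>Y. Y \<in> S ` F \<union> range T \<Longrightarrow> finite (P - Y)"
    by (rule pseudointersection_if_small) (auto simp: pseudointersection_def)
  define B where "B = (\<Union>c\<in>P. fs c)"
  have "B \<notin> J"
  proof
    assume "B \<in> J"
    then obtain n where n: "B \<in> C n" using C(1) by blast
    \<comment> \<open>A code in \<open>T n\<close> has level at least \<open>n\<close>, so it also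
      rules out \<open>B \<in> C n\<close>, as \<open>C\<close> increases.\<close>
    have "P \<inter> T n \<noteq> {}" using P(1) P(2)[of "T n"] by (metis Diff_triv UnCI rangeI)
    then obtain c where c: "c \<in> P" "c \<in> T n" by blast
    have "C n \<subseteq> C (lev c)" using C(2) c(2) by (simp add: incseq_def T_def)
    then show False using c n by (auto simp: T_def B_def)
  qed
  moreover have "B - A \<in> J" if "A \<in> F" for A
  proof -
    \<comment> \<open>Only finitely many codes in \<open>P\<close> stand for sets not inside
      \<open>A\<close>, so \<open>B - A\<close> is even finite.\<close>
    have "finite (\<Union>c\<in>P - S A. fs c)" using P(2)[of "S A"] that by (auto simp: fs_def)
    moreover have "B - A \<subseteq> (\<Union>c\<in>P - S A. fs c)" by (auto simp: B_def S_def)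
    ultimately show ?thesis using ideal_on_finite[OF J] finite_subset by blast
  qed
  ultimately show ?thesis by blast
qed

section \<open>Towers of positive sets\<close>

text \<open>Among finitely many indices one is last, and its set is contained, up to a set in
  \<open>J\<close>, in all the others.\<close>

lemma positive_fip_tower:
  assumes J: "ideal_on UNIV J" and r: "Well_order r" and X: "X \<subseteq> Field r"
    and pos: "\<And>i. i \<in> X \<Longrightarrow> f i \<notin> J"
    and dec: "\<And>i j. i \<in> X \<Longrightarrow> j \<in> X \<Longrightarrow> i \<in> underS r j \<Longrightarrow> f j - f i \<in> J"
  shows "positive_fip J (f ` X)"
  unfolding positive_fip_def
proof (intro allI impI)
  fix G assume "G \<subseteq> f ` X \<and> finite G"
  then have "finite G" "G \<subseteq> f ` X" by simp_all
  from finite_subset_image[OF this]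
  obtain Y where Y: "Y \<subseteq> X" "finite Y" "G = f ` Y"
    by (elim exE conjE) (rule that)
  show "\<Inter>G \<notin> J"
  proof (cases "Y = {}")
    case True
    then show ?thesis using Y(3) ideal_on_space[OF J] by simp
  next
    case False
    have "\<exists>m\<in>Y. \<forall>y\<in>Y. y = m \<or> y \<in> underS r m"
      using Y(2) False Y(1)
    proof (induction Y rule: finite_ne_induct)
      case (insert y Y)
      then obtain m where m: "m \<in> Y" "\<forall>z\<in>Y. z = m \<or> z \<in> underS r m" by blast
      have "y \<in> Field r" "m \<in> Field r" using insert.prems X m(1) by blast+
      then consider "y = m" | "y \<in> underS r m" | "m \<in> underS r y"
        using r unfolding well_order_on_def linear_order_on_def total_on_def underS_def by blast
      then show ?case
      proof cases
        case 3
        then have "z \<in> underS r y" if "z \<in> underS r m" for z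
          using that r unfolding well_order_on_def linear_order_on_def partial_order_on_def
            preorder_on_def trans_def antisym_def underS_def by blast
        then show ?thesis using m 3 by (intro bexI[of _ y]) auto
      qed (use m in \<open>auto intro!: bexI[of _ m]\<close>)
    qed simp
    then obtain m where m: "m \<in> Y" "\<And>y. y \<in> Y \<Longrightarrow> y = m \<or> y \<in> underS r m" by blast
    have "f m - f y \<in> J" if "y \<in> Y" for y
      using m(2)[OF that]
    proof
      assume "y = m"
      then show ?thesis using ideal_on_finite[OF J] by simp
    next
      assume "y \<in> underS r m"
      then show ?thesis using dec m(1) that Y(1) by blast
    qed
    then have "(\<Union>y\<in>Y. f m - f y) \<in> J" by (intro ideal_on_UN[OF J Y(2)])
    moreover have "f m \<subseteq> \<Inter>G \<union> (\<Union>y\<in>Y. f m - f y)" unfolding Y(3) by blast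
    moreover have "f m \<notin> J" using pos m(1) Y(1) by blast
    ultimately show ?thesis using ideal_on_Un[OF J] ideal_on_subset[OF J] by meson
  qed
qed

text \<open>Recursion along a cardinal well-order of \<open>I\<close>: a proper initial segment has
  fewer than \<open>\<kappa>\<close> elements, so \<open>small\<close> bounds the sets chosen so
  far, and \<open>dense\<close> shrinks the bound to satisfy the next requirement.\<close>

lemma generic_tower:
  fixes J :: "'a set set" and \<kappa> :: "'k rel" and I :: "'i set"
  assumes J: "ideal_on UNIV J"
    and small: "\<And>F. |F| <o \<kappa> \<Longrightarrow> positive_fip J F \<Longrightarrow> \<exists>B. B \<notin> J \<and> (\<forall>A\<in>F. B - A \<in> J)"
    and I: "|I| \<le>o \<kappa>"
    and dense: "\<And>i A. i \<in> I \<Longrightarrow> A \<notin> J \<Longrightarrow> \<exists>B\<subseteq>A. B \<notin> J \<and> Q i B"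
  obtains f where "\<And>i. i \<in> I \<Longrightarrow> Q i (f i)" "positive_fip J (f ` I)"
proof -
  define r where "r = |I|"
  have r: "Well_order r" "Card_order r" "Field r = I"
    unfolding r_def by (simp_all add: card_of_card_order_on card_of_well_order_on Field_card_of)
  have "wf (r - Id)" using r(1) by (simp add: well_order_on_def)
  have mem: "(i, j) \<in> r - Id \<longleftrightarrow> i \<in> underS r j" for i j
    by (auto simp: underS_def)
  \<comment> \<open>Vacuous outside \<open>I\<close>, since the recursion ranges over the whole
    type.\<close>
  define R where "R f i B \<longleftrightarrow> (i \<in> I \<longrightarrow> B \<notin> J \<and> Q i B \<and> (\<forall>j\<in>underS r i. B - f j \<in> J))"
    for f :: "'i \<Rightarrow> 'a set" and i B
  have "\<exists>f. \<forall>i. R f i (f i)"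
  proof (rule dependent_wf_choice[OF \<open>wf (r - Id)\<close>])
    fix f g :: "'i \<Rightarrow> 'a set" and i B
    assume "\<And>j. (j, i) \<in> r - Id \<Longrightarrow> f j = g j"
    then show "R f i B = R g i B" unfolding R_def mem by simp
  next
    fix i f assume "\<And>j. (j, i) \<in> r - Id \<Longrightarrow> R f j (f j)"
    then have IH: "R f j (f j)" if "j \<in> underS r i" for j using that mem by blast
    show "\<exists>B. R f i B"
    proof (cases "i \<in> I")
      case True
      have sub: "underS r i \<subseteq> I" using r(3) by (auto simp: underS_def intro: FieldI1)
      have "positive_fip J (f ` underS r i)"
        using IH sub by (intro positive_fip_tower[OF J r(1)]) (auto simp: R_def r(3))
      moreover have "|f ` underS r i| <o \<kappa>"
        using ordLeq_ordLess_trans[OF card_of_image card_of_underS[OF r(2)]] True r(3)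
          ordLess_ordLeq_trans[OF _ I] unfolding r_def by blast
      ultimately obtain A where A: "A \<notin> J" "\<And>j. j \<in> underS r i \<Longrightarrow> A - f j \<in> J"
        using small by blast
      obtain B where B: "B \<subseteq> A" "B \<notin> J" "Q i B" using dense[OF True A(1)] by blast
      have "B - f j \<in> J" if "j \<in> underS r i" for j
        by (rule ideal_on_subset[OF J A(2)[OF that]]) (use B(1) in blast)
      then show ?thesis using B unfolding R_def by blast
    qed (simp add: R_def)
  qed
  then obtain f where "\<And>i. R f i (f i)" by blast
  then have f: "i \<in> I \<Longrightarrow> f i \<notin> J" "i \<in> I \<Longrightarrow> Q i (f i)"
      "i \<in> I \<Longrightarrow> j \<in> underS r i \<Longrightarrow> f i - f j \<in> J" for i j
    unfolding R_def by blast+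
  have "positive_fip J (f ` I)"
    using f by (intro positive_fip_tower[OF J r(1)]) (auto simp: r(3))
  then show thesis using that f(2) by blast
qed

section \<open>From the tower to a Q-point\<close>

text \<open>A family maximal for \<open>positive_fip J\<close> is an ultrafilter: if it omitted both
  \<open>A\<close> and its complement, finite intersections witnessing this would combine to one in
  \<open>J\<close>.\<close>

lemma ultrafilter_extends_positive_fip:
  fixes J :: "nat set set"
  assumes J: "ideal_on UNIV J" and F: "positive_fip J F"
  obtains U where "ultrafilter_nat U" "F \<subseteq> U" "U \<inter> J = {}"
proof -
  let ?A = "{M. F \<subseteq> M \<and> positive_fip J M}"
  have "\<exists>M\<in>?A. \<forall>X\<in>?A. M \<subseteq> X \<longrightarrow> X = M"
  proof (rule subset_Zorn_nonempty)
    show "?A \<noteq> {}" using F by blast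
    fix C assume C: "C \<noteq> {}" "subset.chain ?A C"
    then have sub: "C \<subseteq> ?A" by (simp add: subset_chain_def)
    have "positive_fip J (\<Union>C)"
      unfolding positive_fip_def
    proof (intro allI impI)
      fix G assume G: "G \<subseteq> \<Union>C \<and> finite G"
      obtain M where "M \<in> C" "G \<subseteq> M"
        using finite_subset_Union_chain[of G C ?A] G C by blast
      then show "\<Inter>G \<notin> J" using G sub by (auto simp: positive_fip_def)
    qed
    then show "\<Union>C \<in> ?A" using C(1) sub by blast
  qed
  then obtain U where U: "F \<subseteq> U" "positive_fip J U"
    and max: "\<And>X. U \<subseteq> X \<Longrightarrow> positive_fip J X \<Longrightarrow> X = U"
    by (metis (mono_tags, lifting) mem_Collect_eq order_trans)
  \<comment> \<open>Maximality, as a membership test: \<open>A\<close> belongs to \<open>U\<close>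
    once it meets all finite intersections of \<open>U\<close> in positive sets.\<close>
  have in_U: "A \<in> U" if A: "\<And>G. G \<subseteq> U \<Longrightarrow> finite G \<Longrightarrow> A \<inter> \<Inter>G \<notin> J" for A
  proof -
    have "positive_fip J (insert A U)"
      unfolding positive_fip_def
    proof (intro allI impI)
      fix G assume G: "G \<subseteq> insert A U \<and> finite G"
      then have "A \<inter> \<Inter>(G - {A}) \<notin> J" by (intro A) auto
      moreover have "A \<inter> \<Inter>(G - {A}) \<subseteq> \<Inter>G" by blast
      ultimately show "\<Inter>G \<notin> J" using ideal_on_subset[OF J] by blast
    qed
    then show ?thesis using max[of "insert A U"] by blast
  qed
  have UJ: "A \<notin> J" if "A \<in> U" for A
    using positive_fipD[OF U(2), of "{A}"] that by simp
  have closed: "B \<in> U" if "H \<subseteq> U" "finite H" "\<Inter>H \<subseteq> B" for H B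
  proof (rule in_U)
    fix G assume "G \<subseteq> U" "finite G"
    then have "\<Inter>(H \<union> G) \<notin> J"
      using positive_fipD[OF U(2), of "H \<union> G"] that(1,2) by simp
    moreover have "\<Inter>(H \<union> G) \<subseteq> B \<inter> \<Inter>G" using that(3) by blast
    ultimately show "B \<inter> \<Inter>G \<notin> J" using ideal_on_subset[OF J] by blast
  qed
  have compl: "A \<in> U \<or> UNIV - A \<in> U" for A
  proof (rule ccontr)
    assume "\<not> (A \<in> U \<or> UNIV - A \<in> U)"
    then obtain G H where GH: "G \<subseteq> U" "finite G" "A \<inter> \<Inter>G \<in> J" "H \<subseteq> U" "finite H"
        "(UNIV - A) \<inter> \<Inter>H \<in> J"
      using in_U by meson
    then have "\<Inter>(G \<union> H) \<notin> J"
      using positive_fipD[OF U(2), of "G \<union> H"] by simp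
    moreover have "\<Inter>(G \<union> H) \<subseteq> (A \<inter> \<Inter>G) \<union> ((UNIV - A) \<inter> \<Inter>H)" by blast
    ultimately show False using ideal_on_Un[OF J] ideal_on_subset[OF J] GH by meson
  qed
  have "ultrafilter_nat U"
    unfolding ultrafilter_nat_def
  proof (intro conjI ballI allI impI)
    show "{} \<notin> U" using UJ ideal_on_finite[OF J] by blast
    show "A \<inter> B \<in> U" if "A \<in> U" "B \<in> U" for A B using closed[of "{A, B}"] that by simp
    show "B \<in> U" if "A \<in> U" "A \<subseteq> B" for A B using closed[of "{A}"] that by simp
    show "A \<in> U \<or> UNIV - A \<in> U" for A by (rule compl)
    show "A \<in> U" if "finite (UNIV - A)" for A
      using compl[of A] UJ ideal_on_finite[OF J _ that] by blast
  qed
  then show thesis using that U(1) UJ by blast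
qed

text \<open>Adding one chosen point of each missed block (the set \<open>E\<close>) completes a
  partial selector; the larger set stays in \<open>U\<close>.\<close>

lemma Q_point_if_partial_selectors:
  assumes U: "ultrafilter_nat U"
    and sel: "\<And>P. partition_on UNIV P \<Longrightarrow> \<forall>p\<in>P. finite p \<Longrightarrow> \<exists>A\<in>U. partial_selector P A"
  shows "Q_point U"
  unfolding Q_point_def
proof (intro conjI allI impI U)
  fix P :: "nat set set" assume P: "partition_on UNIV P \<and> (\<forall>p\<in>P. finite p)"
  then obtain A where A: "A \<in> U" "partial_selector P A" using sel by blast
  define E where "E = {SOME x. x \<in> p | p. p \<in> P \<and> A \<inter> p = {}}"
  have ne: "(SOME x. x \<in> p) \<in> p" if "p \<in> P" for p
  proof -
    have "p \<noteq> {}" using P that by (metis partition_onD3)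
    then show ?thesis by (simp add: some_in_eq)
  qed
  have uniq: "p = q" if "p \<in> P" "q \<in> P" "x \<in> p" "x \<in> q" for p q x
    using P that partition_on_unique[of UNIV P] by blast
  have "card ((A \<union> E) \<inter> p) = 1" if p: "p \<in> P" for p
  proof (cases "A \<inter> p = {}")
    case True
    have "E \<inter> p = {SOME x. x \<in> p}"
    proof
      show "E \<inter> p \<subseteq> {SOME x. x \<in> p}"
        using ne uniq[OF _ p] unfolding E_def by blast
      show "{SOME x. x \<in> p} \<subseteq> E \<inter> p" using ne p True unfolding E_def by blast
    qed
    then show ?thesis using True by (simp add: Int_Un_distrib2)
  next
    case False
    then obtain x where x: "x \<in> A \<inter> p" by blast
    have "A \<inter> p = {x}" using A(2) p x unfolding partial_selector_def by blast
    moreover have "E \<inter> p = {}"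
      using ne uniq[OF _ p] False unfolding E_def by blast
    ultimately show ?thesis by (simp add: Int_Un_distrib2)
  qed
  moreover have "A \<union> E \<in> U"
    by (rule ultrafilter_nat_mono[OF U A(1)]) simp
  ultimately show "\<exists>A\<in>U. \<forall>p\<in>P. card (A \<inter> p) = 1" by blast
qed

text \<open>Such a partition is a subset of the countable set of finite subsets of \<omega>.\<close>

lemma card_finite_partitions:
  "|{P. partition_on UNIV P \<and> (\<forall>p\<in>P. finite p)} :: nat set set set| \<le>o continuum"
proof -
  obtain h :: "nat set \<Rightarrow> nat" where h: "inj_on h {p. finite p}"
    using countable_Collect_finite unfolding countable_def by blast
  have "|Pow {p :: nat set. finite p}| \<le>o |UNIV :: nat set set|"
    by (rule card_of_ordLeqI[OF inj_on_image_Pow[OF h]]) simp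
  then have "|Pow {p :: nat set. finite p}| \<le>o continuum"
    by (rule ordLeq_ordIso_trans[OF _ ordIso_symmetric[OF continuum_ordIso]])
  moreover have "|{P. partition_on UNIV P \<and> (\<forall>p\<in>P. finite p)} :: nat set set set| \<le>o |Pow {p :: nat set. finite p}|"
    by (rule card_of_mono1) blast
  ultimately show ?thesis by (rule ordLeq_transitive[rotated])
qed

text \<open>The tower is indexed by the partitions into finite sets. The hypothesis
  \<open>small\<close> isolates what CH, or \<open>F_sigma J\<close> with
  \<open>p_number =o continuum\<close>, has to provide.\<close>

lemma Q_point_not_J_point_exists:
  assumes J: "ideal_on UNIV J" and hom: "KB_homogeneous UNIV J"
    and nle: "\<not> KB_le Delta ED_Fin UNIV J"
    and small: "\<And>F. |F| <o continuum \<Longrightarrow> positive_fip J F \<Longrightarrow>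
                  \<exists>B. B \<notin> J \<and> (\<forall>A\<in>F. B - A \<in> J)"
  shows "\<exists>U. Q_point U \<and> \<not> J_point J U"
proof -
  let ?I = "{P. partition_on UNIV P \<and> (\<forall>p\<in>P. finite p)} :: nat set set set"
  obtain f where f: "\<And>P. P \<in> ?I \<Longrightarrow> partial_selector P (f P)" "positive_fip J (f ` ?I)"
    by (rule generic_tower[where Q = partial_selector, OF J small card_finite_partitions])
       (use positive_partial_selector[OF J hom nle] in auto)
  obtain U where U: "ultrafilter_nat U" "f ` ?I \<subseteq> U" "U \<inter> J = {}"
    by (rule ultrafilter_extends_positive_fip[OF J f(2)])
  \<comment> \<open>\<open>U\<close> avoids \<open>J\<close>, so \<open>J \<subseteq> dual U\<close>
    and the identity is the required injection.\<close>
  have "B \<in> dual U" if "B \<in> J" for B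
  proof -
    have "UNIV - B \<in> U" using ultrafilter_nat_compl[OF U(1)] U(3) that by blast
    moreover have "B = UNIV - (UNIV - B)" by blast
    ultimately show ?thesis unfolding dual_def by blast
  qed
  then have "P_le UNIV J UNIV (dual U)"
    unfolding P_le_def by (intro exI[of _ "\<lambda>x. x"]) simp
  then have "\<not> J_point J U" by (simp add: J_point_def)
  moreover have "Q_point U"
    using f(1) U(2) by (intro Q_point_if_partial_selectors[OF U(1)]) blast
  ultimately show ?thesis by blast
qed

theorem theorem8p5:
  fixes J :: "nat set set"
  assumes "ideal_on UNIV J" and "P_plus_ideal UNIV J" and "KB_homogeneous UNIV J"
  shows "(CH \<longrightarrow>
            (\<not> KB_le Delta ED_Fin UNIV J \<longleftrightarrow> (\<exists>U. Q_point U \<and> \<not> J_point J U)) \<and>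
            ((\<exists>U. Q_point U \<and> \<not> J_point J U) \<longleftrightarrow>
             (\<exists>U. Q_point U \<and> \<not> weak_J_ultrafilter J U))) \<and>
         (F_sigma J \<and> p_number =o continuum \<longrightarrow>
            (\<not> KB_le Delta ED_Fin UNIV J \<longleftrightarrow> (\<exists>U. Q_point U \<and> \<not> J_point J U)) \<and>
            ((\<exists>U. Q_point U \<and> \<not> J_point J U) \<longleftrightarrow>
             (\<exists>U. Q_point U \<and> \<not> weak_J_ultrafilter J U)))"
proof -
  let ?Q = "\<exists>U. Q_point U \<and> \<not> J_point J U"
  have point: "J_point J U \<longleftrightarrow> \<not> P_le UNIV J UNIV (dual U)"
    and weak_point: "weak_J_ultrafilter J U \<longleftrightarrow> \<not> KB_le UNIV J UNIV (dual U)"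
    if "Q_point U" for U
    using that by (simp_all add: Q_point_def J_point_def weak_J_ultrafilter_def)
  have weak: "\<exists>U. Q_point U \<and> \<not> weak_J_ultrafilter J U" if Q: ?Q
  proof -
    obtain U where U: "Q_point U" "P_le UNIV J UNIV (dual U)" using Q point by blast
    then show ?thesis using weak_point[OF U(1)] P_le_imp_KB_le[OF U(2)] by blast
  qed
  have nle: "\<not> KB_le Delta ED_Fin UNIV J"
    if weak: "\<exists>U. Q_point U \<and> \<not> weak_J_ultrafilter J U"
  proof -
    obtain U where U: "Q_point U" "KB_le UNIV J UNIV (dual U)" using weak weak_point by blast
    then show ?thesis using ED_Fin_not_KB_le_Q_point[OF U(1)] KB_le_trans[OF _ U(2)] by blast
  qed
  \<comment> \<open>\<open>weak\<close> leads from (b) to (c) and \<open>nle\<close> from (c) to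
    (a); each of the two cases then supplies the step from (a) to (b).\<close>
  have equiv: "(\<not> KB_le Delta ED_Fin UNIV J \<longleftrightarrow> ?Q) \<and>
      (?Q \<longleftrightarrow> (\<exists>U. Q_point U \<and> \<not> weak_J_ultrafilter J U))"
    if "\<not> KB_le Delta ED_Fin UNIV J \<Longrightarrow> ?Q"
    using that weak nle by argo
  note exists = Q_point_not_J_point_exists[OF assms(1,3)]
  show ?thesis
  proof (intro conjI[of "_ \<longrightarrow> _"] impI)
    assume CH
    show "(\<not> KB_le Delta ED_Fin UNIV J \<longleftrightarrow> ?Q) \<and>
        (?Q \<longleftrightarrow> (\<exists>U. Q_point U \<and> \<not> weak_J_ultrafilter J U))"
      by (intro equiv exists CH_lower_bound[OF \<open>CH\<close> assms(1,2)])
  next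
    assume "F_sigma J \<and> p_number =o continuum"
    then show "(\<not> KB_le Delta ED_Fin UNIV J \<longleftrightarrow> ?Q) \<and>
        (?Q \<longleftrightarrow> (\<exists>U. Q_point U \<and> \<not> weak_J_ultrafilter J U))"
      by (intro equiv exists F_sigma_lower_bound[OF _ _ assms(1)]) simp_all
  qed
qed

end
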